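(* The number of connected components is stable under 2-switch: for every graph $G$ and every 2-switch $\tau$, $|\kappa(\tau(G))-\kappa(G)|\le 1$.
   Context: Graphs are finite, simple, undirected and labeled. $\kappa(G)$ denotes the number of connected components of $G$. For vertices $a,b,c,d$, the 2-switch $\tau=\binom{a\ b}{c\ d}$ maps $G$ to $G-ab-cd+ac+bd$ if $ab,cd\in E(G)$, $\{a,b\}\cap\{c,d\}=\varnothing$ and $ac,bd\notin E(G)$, and to $G$ otherwise. *)

theory Defs
  imports "Graph_Theory.Digraph_Component"
begin

text \<open>
  A finite simple undirected graph is a \<^locale>\<open>pair_graph\<close>: finitely many vertices, no loops, and
  an irreflexive symmetric arc relation in which the edge \<open>uv\<close> is the pair of arcs \<open>(u, v)\<close>,
  \<open>(v, u)\<close>. Vertices are labels from the type, and equality of graphs is labeled equality.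
\<close>

definition components :: "'a pair_pre_digraph \<Rightarrow> ('a, 'a \<times> 'a) pre_digraph set" where
  "components G = {H. pre_digraph.max_subgraph (with_proj G) connected H}"

definition kappa :: "'a pair_pre_digraph \<Rightarrow> nat" where
  "kappa G = card (components G)"

text \<open>
  The four vertices need not belong to \<open>G\<close>: if one does not, then \<open>ab\<close> or \<open>cd\<close> is not an edge and
  the switch fixes \<open>G\<close>.
\<close>

definition two_switch :: "'a \<Rightarrow> 'a \<Rightarrow> 'a \<Rightarrow> 'a \<Rightarrow> 'a pair_pre_digraph \<Rightarrow> 'a pair_pre_digraph" where
  "two_switch a b c d G =
     (if (a, b) \<in> parcs G \<and> (c, d) \<in> parcs G \<and> {a, b} \<inter> {c, d} = {} \<and>
         (a, c) \<notin> parcs G \<and> (b, d) \<notin> parcs G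
      then G\<lparr>parcs := parcs G - {(a, b), (b, a), (c, d), (d, c)}
                             \<union> {(a, c), (c, a), (b, d), (d, b)}\<rparr>
      else G)"

lemma pair_graph_two_switch:
  assumes "pair_graph G"
  shows "pair_graph (two_switch a b c d G)"
proof -
  interpret pair_graph G by fact
  have s: "(v, u) \<in> parcs G" if "(u, v) \<in> parcs G" for u v
    using that graph_symmetric[of u v] by simp
  show ?thesis
  proof (cases "two_switch a b c d G = G")
    case True
    then show ?thesis using assms by simp
  next
    case False
    then have c: "(a, b) \<in> parcs G" "(c, d) \<in> parcs G" "{a, b} \<inter> {c, d} = {}"
      by (auto simp: two_switch_def split: if_splits)
    have P: "parcs (two_switch a b c d G) = parcs G - {(a, b), (b, a), (c, d), (d, c)}
                             \<union> {(a, c), (c, a), (b, d), (d, b)}"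
      and V: "pverts (two_switch a b c d G) = pverts G"
      using False by (auto simp: two_switch_def split: if_splits)
    have v: "a \<in> pverts G" "b \<in> pverts G" "c \<in> pverts G" "d \<in> pverts G"
      using c(1,2) by (auto dest: wellformed')
    show ?thesis
    proof unfold_locales
      fix e assume "e \<in> parcs (two_switch a b c d G)"
      then show "fst e \<in> pverts (two_switch a b c d G)" "snd e \<in> pverts (two_switch a b c d G)"
        "fst e \<noteq> snd e"
        using c v unfolding P V by (auto dest: arc_fst_in_verts arc_snd_in_verts pair_no_loops)
    next
      show "finite (pverts (two_switch a b c d G))" "finite (parcs (two_switch a b c d G))"
        unfolding P V using pair_finite_verts pair_finite_arcs by auto
    next
      show "symmetric (with_proj (two_switch a b c d G))"
        unfolding symmetric_def with_proj_simps P sym_def using s by blast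
    qed
  qed
qed

lemma components_eq_sccs:
  assumes "pair_graph G"
  shows "components G = pre_digraph.sccs (with_proj G)"
proof -
  interpret pair_graph G by fact
  have "arc_mono connected"
    unfolding arc_mono_def
    by (metis spanning_def subgraph_def wf_digraph.connected_spanning_imp_connected)
  have sc: "strongly_connected H" if "induced_subgraph H (with_proj G)" "connected H" for H
    using that induced_graph_imp_symmetric[OF sym_arcs that(1)]
    by (meson induced_imp_subgraph subgraph_def wf_digraph.symmetric_connected_imp_strongly_connected)
  have co: "connected H" if "subgraph H (with_proj G)" "strongly_connected H" for H
    using that wf_digraph.reachable_mk_symmetricI[of H]
    by (auto simp: connected_def strongly_connected_def subgraph_def)
  show ?thesis
  proof (intro set_eqI iffI)
    fix H assume "H \<in> components G"
    then have m: "max_subgraph connected H" by (simp add: components_def)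
    then have "induced_subgraph H (with_proj G)"
      using \<open>arc_mono connected\<close> by (rule induced_subgraphI_arc_mono)
    with m show "H \<in> sccs"
      unfolding sccs_altdef2 max_subgraph_def using sc co by blast
  next
    fix H assume "H \<in> sccs"
    then have m: "induced_subgraph H (with_proj G)" "strongly_connected H"
      and n: "\<And>H'. induced_subgraph H' (with_proj G) \<Longrightarrow> strongly_connected H' \<Longrightarrow> \<not> verts H \<subset> verts H'"
      by (auto simp: sccs_def)
    have "max_subgraph connected H"
    proof (rule max_subgraphI)
      show s: "subgraph H (with_proj G)" using m(1) by (rule induced_imp_subgraph)
      then show "connected H" using m(2) by (rule co)
      fix K assume K: "H \<noteq> K" "subgraph H K" "subgraph K (with_proj G)"
      show "\<not> connected K"
      proof
        assume c: "connected K"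
        let ?L = "with_proj G \<restriction> verts K"
        have i: "induced_subgraph ?L (with_proj G)"
          using K(3) by (intro induced_induce) (auto simp: subgraph_def)
        have "subgraph K ?L" using K(3) by (rule subgraph_induce_subgraphI2)
        then have "connected ?L"
          using c \<open>arc_mono connected\<close> unfolding arc_mono_def by (metis induce_subgraph_verts)
        then have "\<not> verts H \<subset> verts K" using n[OF i sc[OF i]] by simp
        then have v: "verts H = verts K" using K(2) by (auto simp: subgraph_def)
        then have "arcs H = arcs K"
          using K m(1) unfolding induced_subgraph_def subgraph_def compatible_def
          by (auto dest: wf_digraph.wellformed)
        then show False
          using K v by (auto simp: subgraph_def compatible_def)
      qed
    qed
    then show "H \<in> components G" by (simp add: components_def)
  qed
qed

lemma finite_components:
  assumes "pair_graph G"
  shows "finite (components G)"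
proof -
  interpret pair_graph G by fact
  show ?thesis
    unfolding components_eq_sccs[OF assms] sccs_conv_sccs_verts
    using finite_sccs_verts by simp
qed

end

theory Submission
  imports Defs
begin

text \<open>
  Every edge that a 2-switch creates joins two vertices of \<open>A \<union> C\<close>, where \<open>A\<close> and \<open>C\<close> are the
  components of \<open>a\<close> and \<open>c\<close> in the old graph: \<open>b\<close> lies in \<open>A\<close> and \<open>d\<close> in \<open>C\<close>. So merging \<open>A\<close> with \<open>C\<close>
  gives a partition that is coarser than the new components, and the number of components drops by
  at most one. The inverse of a 2-switch is again a 2-switch, hence the number also grows by at most
  one.
\<close>

text \<open>Sending each \<open>R\<close>-class to the \<open>R'\<close>-class of a chosen
  representative can identify two distinct classes only if both are among those of \<open>x\<close>
  and \<open>y\<close>. With the class of \<open>x\<close> left out the map is injective, and the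
  left-out class costs the \<open>+ 1\<close>.\<close>

lemma card_quotient_le_Suc:
  assumes "finite V" "equiv V R" "equiv V R'"
    and sub: "R' \<subseteq> R \<union> R `` {x, y} \<times> R `` {x, y}"
  shows "card (V // R) \<le> card (V // R') + 1"
proof -
  define rep where "rep K = (SOME k. k \<in> K)" for K :: "'a set"
  have rep: "rep K \<in> K" "rep K \<in> V" "K = R `` {rep K}" if "K \<in> V // R" for K
  proof -
    show *: "rep K \<in> K"
      unfolding rep_def using in_quotient_imp_non_empty[OF assms(2) that] by (simp add: some_in_eq)
    show "rep K \<in> V" using * in_quotient_imp_subset[OF assms(2) that] by blast
    obtain z where z: "K = R `` {z}" using \<open>K \<in> V // R\<close> by (auto simp: quotient_def)
    then have "(z, rep K) \<in> R" using * by blast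
    then have "R `` {z} = R `` {rep K}" by (rule equiv_class_eq[OF assms(2)])
    then show "K = R `` {rep K}" using z by (rule trans[rotated])
  qed
  let ?Q = "V // R - {R `` {x}}"
  have inj: "inj_on (\<lambda>K. R' `` {rep K}) ?Q"
  proof (rule inj_onI)
    fix K L assume K: "K \<in> ?Q" and L: "L \<in> ?Q" and eq: "R' `` {rep K} = R' `` {rep L}"
    then have "(rep K, rep L) \<in> R'"
      using rep(2) by (simp add: eq_equiv_class[OF _ assms(3)])
    \<comment> \<open>Neither representative is related to \<open>x\<close>, so a pair inside the
      merged block has both entries in the class of \<open>y\<close>.\<close>
    moreover have "(rep K, rep L) \<in> R" if "(rep K, rep L) \<in> R `` {x, y} \<times> R `` {x, y}"
    proof -
      have "(x, rep M) \<notin> R" if "M \<in> ?Q" for M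
        using that rep(3)[of M] equiv_class_eq[OF assms(2), of x "rep M"] by blast
      then have "(x, rep K) \<notin> R" "(x, rep L) \<notin> R"
        using K L by blast+
      then have "(y, rep K) \<in> R" "(y, rep L) \<in> R" using that by auto
      then show ?thesis using assms(2) by (auto elim: equivE dest: symD transD)
    qed
    ultimately have "(rep K, rep L) \<in> R" using sub by blast
    then have "R `` {rep K} = R `` {rep L}" by (rule equiv_class_eq[OF assms(2)])
    then show "K = L" using K L rep(3)[of K] rep(3)[of L] by blast
  qed
  have img: "(\<lambda>K. R' `` {rep K}) ` ?Q \<subseteq> V // R'"
    using rep(2) by (auto intro: quotientI)
  have fin: "finite (V // R')" using assms(1,3) by (simp add: finite_quotient equiv_type)
  have "card (V // R) \<le> card ?Q + 1"
    by (cases "finite (V // R)") (auto simp: card_Diff_singleton_if)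
  also have "card ?Q \<le> card (V // R')" using card_inj_on_le[OF inj img fin] .
  finally show ?thesis by simp
qed

text \<open>Packed as a set of pairs so that \<open>equiv\<close> and the quotient \<open>//\<close>
  apply.\<close>

definition reach :: "'a pair_pre_digraph \<Rightarrow> 'a rel" where
  "reach G = {(u, v). u \<rightarrow>\<^sup>*\<^bsub>with_proj G\<^esub> v}"

lemma equiv_reach:
  assumes "pair_graph G"
  shows "equiv (pverts G) (reach G)"
proof -
  interpret pair_graph G by fact
  show ?thesis
  proof (intro equivI refl_onI symI transI)
    show "reach G \<subseteq> pverts G \<times> pverts G"
      by (auto simp: reach_def dest: reachable_in_verts)
    show "(u, u) \<in> reach G" if "u \<in> pverts G" for u
      using that by (simp add: reach_def)
    show "(v, u) \<in> reach G" if "(u, v) \<in> reach G" for u v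
      using that symmetric_reachable' by (simp add: reach_def)
    show "(u, w) \<in> reach G" if "(u, v) \<in> reach G" "(v, w) \<in> reach G" for u v w
      using that reachable_trans[of u v w] by (simp add: reach_def)
  qed
qed

lemma arc_in_reach:
  assumes "pair_graph G" "(u, v) \<in> parcs G"
  shows "(u, v) \<in> reach G"
proof -
  interpret pair_graph G by fact
  show ?thesis using assms(2) by (auto simp: reach_def arcs_ends_conv)
qed

text \<open>Components are strongly connected components, and by symmetry of reachability their
  vertex sets are exactly the \<open>reach G\<close>-classes.\<close>

lemma kappa_eq_card_quotient:
  assumes "pair_graph G"
  shows "kappa G = card (pverts G // reach G)"
proof -
  interpret pair_graph G by fact
  have "scc_of u = reach G `` {u}" for u
    by (auto simp: scc_of_def reach_def dest: symmetric_reachable')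
  then have "sccs_verts = pverts G // reach G"
    unfolding sccs_verts_conv_scc_of quotient_def by auto
  then show ?thesis
    using card_sccs_verts by (simp add: kappa_def components_eq_sccs[OF assms])
qed

text \<open>The relation bounding \<open>parcs H\<close> is reachability in \<open>G\<close> with
  the classes of \<open>x\<close> and \<open>y\<close> merged. Being transitive, it contains along
  with the arcs of \<open>H\<close> every pair joined by a path in \<open>H\<close>.\<close>

lemma kappa_le_Suc:
  assumes "pair_graph G" "pair_graph H" "pverts H = pverts G"
    and arcs: "parcs H \<subseteq> reach G \<union> reach G `` {x, y} \<times> reach G `` {x, y}"
  shows "kappa G \<le> kappa H + 1"
proof -
  interpret H: pair_graph H by fact
  let ?S = "reach G \<union> reach G `` {x, y} \<times> reach G `` {x, y}"
  note eq = equiv_reach[OF assms(1)]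
  have sym: "(v, u) \<in> reach G" if "(u, v) \<in> reach G" for u v
    using eq that by (auto elim: equivE dest: symD)
  have tr: "(u, w) \<in> reach G" if "(u, v) \<in> reach G" "(v, w) \<in> reach G" for u v w
    using eq that by (auto elim: equivE dest: transD)
  \<comment> \<open>The merged block is a union of \<open>reach G\<close>-classes, so composing one
    of its pairs with a pair of \<open>reach G\<close> stays inside it.\<close>
  have "trans ?S"
  proof (rule transI)
    fix u v w
    assume "(u, v) \<in> ?S" "(v, w) \<in> ?S"
    then show "(u, w) \<in> ?S" using sym tr by blast
  qed
  have "(u, v) \<in> ?S" if "(u, v) \<in> reach H" for u v
  proof -
    from that have "u \<rightarrow>\<^sup>*\<^bsub>with_proj H\<^esub> v" by (simp add: reach_def)
    then show ?thesis
    proof (induction rule: H.reachable_induct)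
      case base
      then show ?case using eq assms(3) by (auto dest: equiv_class_self)
    next
      case (step v w)
      then have "(v, w) \<in> ?S" using arcs by (auto simp: arcs_ends_conv)
      with step.IH show ?case using \<open>trans ?S\<close> by (blast dest: transD)
    qed
  qed
  then have "reach H \<subseteq> ?S" by (rule subrelI)
  moreover have "finite (pverts G)"
    using H.pair_finite_verts assms(3) by simp
  ultimately show ?thesis
    using card_quotient_le_Suc[OF _ eq] equiv_reach[OF assms(2)] assms(3)
    by (simp add: kappa_eq_card_quotient assms(1,2))
qed

theorem theorem11:
  fixes G :: "'a pair_pre_digraph" and a b c d :: 'a
  assumes "pair_graph G"
  shows "\<bar>int (kappa (two_switch a b c d G)) - int (kappa G)\<bar> \<le> 1"
proof (cases "two_switch a b c d G = G")
  case False
  let ?H = "two_switch a b c d G"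
  have H: "pair_graph ?H" using assms by (rule pair_graph_two_switch)
  have old: "(a, b) \<in> parcs G" "(c, d) \<in> parcs G"
    and V: "pverts ?H = pverts G"
    and E: "parcs ?H = parcs G - {(a, b), (b, a), (c, d), (d, c)} \<union> {(a, c), (c, a), (b, d), (d, b)}"
    using False by (auto simp: two_switch_def split: if_splits)
  have new: "(a, c) \<in> parcs ?H" "(b, d) \<in> parcs ?H" by (auto simp: E)
  have refl: "(v, v) \<in> reach G" "(v, v) \<in> reach ?H" if "v \<in> {a, b, c, d}" for v
  proof -
    interpret pair_graph G by fact
    have "v \<in> pverts G" using that old by (auto dest: wellformed')
    then show "(v, v) \<in> reach G" "(v, v) \<in> reach ?H"
      using equiv_class_self[OF equiv_reach[OF assms]] equiv_class_self[OF equiv_reach[OF H]] V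
      by simp_all
  qed
  \<comment> \<open>Stated in both directions, so that \<open>kappa_le_Suc\<close> applies with the
    roles of the two graphs exchanged.\<close>
  have arcs: "parcs ?H \<subseteq> parcs G \<union> {a, b, c, d} \<times> {a, b, c, d}"
    "parcs G \<subseteq> parcs ?H \<union> {a, b, c, d} \<times> {a, b, c, d}"
    unfolding E by blast+
  have "kappa G \<le> kappa ?H + 1"
  proof (rule kappa_le_Suc[OF assms H V])
    \<comment> \<open>In \<open>G\<close> the edges \<open>ab\<close> and \<open>cd\<close> tie
      \<open>b\<close> to \<open>a\<close> and \<open>d\<close> to \<open>c\<close>.\<close>
    have "{a, b, c, d} \<subseteq> reach G `` {a, c}"
      using old arc_in_reach[OF assms] refl(1) by (simp add: Image_iff)
    then have "{a, b, c, d} \<times> {a, b, c, d} \<subseteq> reach G `` {a, c} \<times> reach G `` {a, c}"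
      by (intro Sigma_mono)
    moreover have "parcs G \<subseteq> reach G" using arc_in_reach[OF assms] by (intro subrelI)
    ultimately show "parcs ?H \<subseteq> reach G \<union> reach G `` {a, c} \<times> reach G `` {a, c}"
      using arcs(1) by (meson Un_mono order_trans)
  qed
  moreover have "kappa ?H \<le> kappa G + 1"
  proof (rule kappa_le_Suc[OF H assms V[symmetric]])
    \<comment> \<open>In \<open>?H\<close> the edges are \<open>ac\<close> and \<open>bd\<close>, so
      the representatives are now \<open>a\<close> and \<open>b\<close>.\<close>
    have "{a, b, c, d} \<subseteq> reach ?H `` {a, b}"
      using new arc_in_reach[OF H] refl(2) by (simp add: Image_iff)
    then have "{a, b, c, d} \<times> {a, b, c, d} \<subseteq> reach ?H `` {a, b} \<times> reach ?H `` {a, b}"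
      by (intro Sigma_mono)
    moreover have "parcs ?H \<subseteq> reach ?H" using arc_in_reach[OF H] by (intro subrelI)
    ultimately show "parcs G \<subseteq> reach ?H \<union> reach ?H `` {a, b} \<times> reach ?H `` {a, b}"
      using arcs(2) by (meson Un_mono order_trans)
  qed
  ultimately show ?thesis by linarith
qed simp

end
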